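(* Let $\mathcal{S}$ be a bi-modal hybrid automaton with equilibrium $x^*$ and let $H\ge 0$. If there is a closed orbit in $\mathcal{S}_H$, then the equilibrium $x^*$ of $\mathcal{S}_H$ is not GAS.
   Context: **Bi-modal hybrid automaton.** Let $n\ge1$, let $g:\mathbb{R}^n\to\mathbb{R}$ be continuously differentiable and let $f_1,f_2:\mathbb{R}^n\to\mathbb{R}^n$ be Lipschitz continuous; $\phi_f(x,t)$ denotes the flow of $\dot x=f(x)$, i.e. the state at time $t$ when the state at time $0$ is $x$. Put $\mathrm{Dom}(1)=\{x\mid g(x)\le 0\}$, $\mathrm{Dom}(2)=\{x\mid g(x)\ge 0\}$. The automaton $\mathcal{S}$ has modes $1,2$; in mode $q$ the state follows $\dot x=f_q(x)$ within $\mathrm{Dom}(q)$; transition $1\to2$ is enabled where $g(x)\ge0$, transition $2\to1$ where $g(x)\le0$; the continuous state is unchanged by transitions. **Delayed system and trajectories.** For $H\ge0$, $\mathcal{S}_H$ is the non-deterministic system in which each transition may be delayed by at most $H$ time units. A trajectory of $\mathcal{S}_H$ is a set $\mathcal{T}=\bigcup_{j=0}^{J-1}\{(q_j,t,x)\mid t_j\le t\le t_{j+1},\ x=\phi_{f_{q_j}}(x_j,t-t_j)\}$, where $J\in\{1,2,\dots\}\cup\{\infty\}$, $t_0<t_1<\cdots$ (if $J$ is finite, $t_J=+\infty$ is allowed, the last interval then being $[t_{J-1},\infty)$; if $J=\infty$ then $t_j\to\infty$), $q_j\in\{1,2\}$, $q_j\ne q_{j-1}$, $x_j=\phi_{f_{q_{j-1}}}(x_{j-1},t_j-t_{j-1})$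 for $j\ge1$, $x_0\in\mathrm{Dom}(q_0)$, $g(x_j)\ge0$ if $(q_{j-1},q_j)=(1,2)$, $g(x_j)\le0$ if $(q_{j-1},q_j)=(2,1)$, and, for every $j$, each connected component of the set of times $t$ in the $j$-th interval with $\phi_{f_{q_j}}(x_j,t-t_j)\notin\mathrm{Dom}(q_j)$ has length at most $H$. Trajectories of $\mathcal{S}$ are those of $\mathcal{S}_0$. **Equilibrium and GAS.** $\mathcal{S}$ has a unique equilibrium $x^*$: $x^*\in\mathrm{int}(\mathrm{Dom}(1))$, $f_1(x^* )=0$, and there is no other pair $(q,x)$ with $x\in\mathrm{Dom}(q)$, $f_q(x)=0$. $x^*$ is globally asymptotically stable (GAS) for $\mathcal{S}_H$ if for every $\varepsilon>0$ there is $\delta>0$ such that every trajectory starting within distance $\delta$ of $x^*$ stays within distance $\varepsilon$ of $x^*$, and every trajectory defined for all future times converges to $x^*$. Standing assumptions: $x^*$ is GAS for $\dot x=f_1(x)$ (mode 1) and for $\mathcal{S}$. **Closed orbit.** A trajectory $\mathcal{T}$ is a closed orbit if there are $(q_0,t_0,x_0),(\tilde q,\tilde t,\tilde x),(\bar q,\bar t,\bar x)\in\mathcal{T}$ with $\bar q=q_0$, $t_0<\tilde t<\bar t$ and $\tilde x\ne\bar x=x_0$. There is a closed orbit in $\mathcal{S}_H$ if some trajectory of $\mathcal{S}_H$ is a closed orbit. *)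

theory Defs
  imports "HOL-Analysis.Analysis"
begin

definition is_solution :: "('a::real_normed_vector \<Rightarrow> 'a) \<Rightarrow> 'a \<Rightarrow> (real \<Rightarrow> 'a) \<Rightarrow> bool" where
  "is_solution f x u \<longleftrightarrow> u 0 = x \<and> (\<forall>t. (u has_vector_derivative f (u t)) (at t))"

text \<open>The definite description is meaningful for globally Lipschitz vector fields on a
  finite-dimensional space, where the initial value problem has exactly one solution on the
  whole real line.\<close>

definition flow :: "('a::real_normed_vector \<Rightarrow> 'a) \<Rightarrow> 'a \<Rightarrow> real \<Rightarrow> 'a" where
  "flow f x = (THE u. is_solution f x u)"

definition continuously_differentiable :: "('a::real_normed_vector \<Rightarrow> real) \<Rightarrow> bool" where
  "continuously_differentiable g \<longleftrightarrow>
     (\<exists>g'. (\<forall>x. (g has_derivative blinfun_apply (g' x)) (at x)) \<and> continuous_on UNIV g')"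

datatype mode = Mode1 | Mode2

fun mode_dom :: "('a \<Rightarrow> real) \<Rightarrow> mode \<Rightarrow> 'a set" where
  "mode_dom g Mode1 = {x. g x \<le> 0}"
| "mode_dom g Mode2 = {x. g x \<ge> 0}"

text \<open>A bi-modal automaton is given by its switching function \<open>g\<close> and the two vector fields
  \<open>f Mode1\<close> and \<open>f Mode2\<close>.\<close>

definition bimodal_automaton ::
    "('a::real_normed_vector \<Rightarrow> real) \<Rightarrow> (mode \<Rightarrow> 'a \<Rightarrow> 'a) \<Rightarrow> bool" where
  "bimodal_automaton g f \<longleftrightarrow>
     continuously_differentiable g \<and> (\<forall>q. \<exists>L. L-lipschitz_on UNIV (f q))"

definition mode_interval :: "(nat \<Rightarrow> ereal) \<Rightarrow> nat \<Rightarrow> real set" where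
  "mode_interval t j = {s. t j \<le> ereal s \<and> ereal s \<le> t (Suc j)}"

text \<open>The state at time \<open>s\<close> of the \<open>j\<close>-th piece, which starts in state \<open>x j\<close> at time \<open>t j\<close>.\<close>

definition piece_state ::
    "(mode \<Rightarrow> 'a::real_normed_vector \<Rightarrow> 'a) \<Rightarrow> (nat \<Rightarrow> ereal) \<Rightarrow> (nat \<Rightarrow> mode) \<Rightarrow> (nat \<Rightarrow> 'a)
      \<Rightarrow> nat \<Rightarrow> real \<Rightarrow> 'a" where
  "piece_state f t q x j s = flow (f (q j)) (x j) (s - real_of_ereal (t j))"

text \<open>An execution with \<open>J\<close> pieces. Only \<open>q j\<close>, \<open>x j\<close> for \<open>j < J\<close> and \<open>t j\<close> for \<open>j \<le> J\<close>
  matter. Since the times \<open>t j\<close> are strictly increasing and \<open>t 0 > -\<infinity>\<close>, all of them are finite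
  except possibly \<open>t J\<close> when \<open>J\<close> is finite; if \<open>t J = \<infinity>\<close>, the last interval is \<open>[t (J - 1), \<infinity>)\<close>.
  The length of a connected component is its Lebesgue measure, so that unbounded components have
  length \<open>\<infinity>\<close>.\<close>

definition execution ::
    "('a::real_normed_vector \<Rightarrow> real) \<Rightarrow> (mode \<Rightarrow> 'a \<Rightarrow> 'a) \<Rightarrow> real
      \<Rightarrow> enat \<Rightarrow> (nat \<Rightarrow> ereal) \<Rightarrow> (nat \<Rightarrow> mode) \<Rightarrow> (nat \<Rightarrow> 'a) \<Rightarrow> bool" where
  "execution g f H J t q x \<longleftrightarrow>
     1 \<le> J \<and>
     t 0 \<noteq> -\<infinity> \<and>
     (\<forall>j. enat j < J \<longrightarrow> t j < t (Suc j)) \<and>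
     (J = \<infinity> \<longrightarrow> t \<longlonglongrightarrow> \<infinity>) \<and>
     x 0 \<in> mode_dom g (q 0) \<and>
     (\<forall>j. enat (Suc j) < J \<longrightarrow>
        q (Suc j) \<noteq> q j \<and>
        x (Suc j) = piece_state f t q x j (real_of_ereal (t (Suc j))) \<and>
        (q j = Mode1 \<and> q (Suc j) = Mode2 \<longrightarrow> g (x (Suc j)) \<ge> 0) \<and>
        (q j = Mode2 \<and> q (Suc j) = Mode1 \<longrightarrow> g (x (Suc j)) \<le> 0)) \<and>
     (\<forall>j. enat j < J \<longrightarrow>
        (\<forall>C \<in> components {s \<in> mode_interval t j. piece_state f t q x j s \<notin> mode_dom g (q j)}.
           emeasure lborel C \<le> ennreal H))"

definition trajectory ::
    "('a::real_normed_vector \<Rightarrow> real) \<Rightarrow> (mode \<Rightarrow> 'a \<Rightarrow> 'a) \<Rightarrow> real \<Rightarrow> (mode \<times> real \<times> 'a) set \<Rightarrow> bool"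
  where
  "trajectory g f H T \<longleftrightarrow>
     (\<exists>J t q x. execution g f H J t q x \<and>
        T = (\<Union>j\<in>{j. enat j < J}. {(q j, s, piece_state f t q x j s) | s. s \<in> mode_interval t j}))"

definition unique_equilibrium ::
    "('a::real_normed_vector \<Rightarrow> real) \<Rightarrow> (mode \<Rightarrow> 'a \<Rightarrow> 'a) \<Rightarrow> 'a \<Rightarrow> bool" where
  "unique_equilibrium g f xs \<longleftrightarrow>
     xs \<in> interior (mode_dom g Mode1) \<and> f Mode1 xs = 0 \<and>
     (\<forall>q x. x \<in> mode_dom g q \<and> f q x = 0 \<longrightarrow> q = Mode1 \<and> x = xs)"

definition GAS_ode :: "('a::real_normed_vector \<Rightarrow> 'a) \<Rightarrow> 'a \<Rightarrow> bool" where
  "GAS_ode f xs \<longleftrightarrow>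
     (\<forall>\<epsilon>>0. \<exists>\<delta>>0. \<forall>x. dist x xs < \<delta> \<longrightarrow> (\<forall>t\<ge>0. dist (flow f x t) xs < \<epsilon>)) \<and>
     (\<forall>x. (flow f x \<longlongrightarrow> xs) at_top)"

definition starts_at :: "(mode \<times> real \<times> 'a) set \<Rightarrow> 'a \<Rightarrow> bool" where
  "starts_at T x0 \<longleftrightarrow> (\<exists>q0 t0. (q0, t0, x0) \<in> T \<and> (\<forall>(q, t, x) \<in> T. t0 \<le> t))"

definition defined_for_all_future :: "(mode \<times> real \<times> 'a) set \<Rightarrow> bool" where
  "defined_for_all_future T \<longleftrightarrow> (\<forall>M. \<exists>(q, t, x) \<in> T. M \<le> t)"

definition converges_to :: "(mode \<times> real \<times> 'a::metric_space) set \<Rightarrow> 'a \<Rightarrow> bool" where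
  "converges_to T xs \<longleftrightarrow> (\<forall>\<epsilon>>0. \<exists>M. \<forall>(q, t, x) \<in> T. M \<le> t \<longrightarrow> dist x xs < \<epsilon>)"

definition GAS ::
    "('a::real_normed_vector \<Rightarrow> real) \<Rightarrow> (mode \<Rightarrow> 'a \<Rightarrow> 'a) \<Rightarrow> real \<Rightarrow> 'a \<Rightarrow> bool" where
  "GAS g f H xs \<longleftrightarrow>
     (\<forall>\<epsilon>>0. \<exists>\<delta>>0. \<forall>T x0. trajectory g f H T \<and> starts_at T x0 \<and> dist x0 xs < \<delta> \<longrightarrow>
        (\<forall>(q, t, x) \<in> T. dist x xs < \<epsilon>)) \<and>
     (\<forall>T. trajectory g f H T \<and> defined_for_all_future T \<longrightarrow> converges_to T xs)"

definition closed_orbit :: "(mode \<times> real \<times> 'a) set \<Rightarrow> bool" where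
  "closed_orbit T \<longleftrightarrow>
     (\<exists>q0 t0 x0 q1 t1 x1 q2 t2 x2.
        (q0, t0, x0) \<in> T \<and> (q1, t1, x1) \<in> T \<and> (q2, t2, x2) \<in> T \<and>
        q2 = q0 \<and> t0 < t1 \<and> t1 < t2 \<and> x1 \<noteq> x2 \<and> x2 = x0)"

end

theory Submission
  imports Defs
begin

text \<open>A closed orbit yields a periodic trajectory, which cannot converge. The loop leaves and
  re-enters a state \<open>x0\<close> in the same mode, in general in the middle of two different pieces;
  repeating it means gluing the part of the last piece before \<open>x0\<close> to the part of the first piece
  after \<open>x0\<close>. Both pieces lie on the same flow line and start in the domain of their mode, because
  the guard of a transition is the domain of its target mode. Hence the time already spent outside
  the domain on reaching \<open>x0\<close> is the same in both pieces, and gluing respects the delay bound. The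
  periodic trajectory starts at the beginning of a piece, hence in the domain. If it converges to
  \<open>xs\<close>, all of its states are \<open>xs\<close>, although a closed orbit has two distinct states.\<close>

section \<open>Flows of globally Lipschitz vector fields\<close>

text \<open>A primitive on the whole line stands in for the integral from 0 to \<open>t\<close> in
  Picard iteration, so that negative times need no sign convention.\<close>

lemma primitive_on_line:
  fixes h :: "real \<Rightarrow> 'a::euclidean_space"
  assumes "continuous_on UNIV h"
  shows "\<exists>F. F 0 = 0 \<and> (\<forall>t. (F has_vector_derivative h t) (at t))"
proof -
  have "isCont h t" for t
    using assms by (simp add: continuous_on_eq_continuous_at)
  then obtain F where F: "\<And>t. (F has_vector_derivative h t) (at t)"
    using einterval_antiderivative[of "-\<infinity>" \<infinity> h] by auto
  then have "((\<lambda>t. F t - F 0) has_vector_derivative h t) (at t)" for t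
    using has_vector_derivative_diff[OF F[of t] has_vector_derivative_const[of "F 0"]] by simp
  then show ?thesis
    by (intro exI[of _ "\<lambda>t. F t - F 0"]) simp
qed

lemma has_vector_derivative_reflect:
  assumes "(u has_vector_derivative u') (at (- t))"
  shows "((\<lambda>s. u (- s)) has_vector_derivative (- u')) (at (t::real))"
proof -
  have "((u \<circ> uminus) has_vector_derivative (- 1) *\<^sub>R u') (at t)"
    using assms by (intro vector_diff_chain_at) (auto intro!: derivative_eq_intros)
  then show ?thesis by (simp add: o_def)
qed

text \<open>Comparison with \<open>c / K * exp (K * s)\<close>, a primitive of the bound, gains the
  factor \<open>1 / K\<close> that makes Picard iteration contract; negative times follow by
  reflection.\<close>

lemma norm_primitive_le_exp:
  fixes F :: "real \<Rightarrow> 'a::real_normed_vector"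
  assumes F0: "F 0 = 0" and F: "\<And>t. (F has_vector_derivative h t) (at t)"
    and h: "\<And>t. norm (h t) \<le> c * exp (K * \<bar>t\<bar>)" and K: "K > 0"
  shows "norm (F t) \<le> c / K * exp (K * \<bar>t\<bar>)"
proof -
  have c: "c \<ge> 0"
    using order_trans[OF norm_ge_zero h[of 0]] by simp
  \<comment> \<open>Stated for an arbitrary primitive \<open>G\<close>, so that it also applies to
    the time reversal of \<open>F\<close>.\<close>
  have forward: "norm (G t) \<le> c / K * exp (K * t)"
    if "t \<ge> 0" and G0: "G 0 = 0" and G: "\<And>s. (G has_vector_derivative k s) (at s)"
      and k: "\<And>s. norm (k s) \<le> c * exp (K * \<bar>s\<bar>)" for G :: "real \<Rightarrow> 'a" and k t
  proof (cases "t = 0")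
    case True
    then show ?thesis using G0 c K by simp
  next
    case False
    have "norm (G t - G 0) \<le> c / K * exp (K * t) - c / K * exp (K * 0)"
    proof (rule differentiable_bound_general[where f' = k and \<phi>' = "\<lambda>s. c * exp (K * s)"])
      show "0 < t" using False that by simp
      show "continuous_on {0..t} G"
        using G by (meson continuous_at_imp_continuous_on has_vector_derivative_continuous)
      show "continuous_on {0..t} (\<lambda>s. c / K * exp (K * s))"
        by (intro continuous_intros)
      show "((\<lambda>s. c / K * exp (K * s)) has_vector_derivative c * exp (K * s)) (at s)" for s
        using K by (auto intro!: derivative_eq_intros simp flip: has_real_derivative_iff_has_vector_derivative)
      show "norm (k s) \<le> c * exp (K * s)" if "0 < s" for s
        using k[of s] that by simp
    qed (rule G)
    moreover have "c / K \<ge> 0" using c K by simp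
    ultimately show ?thesis using G0 by simp
  qed
  show ?thesis
  proof (cases "t \<ge> 0")
    case True
    then show ?thesis using forward[OF True F0 F h] by simp
  next
    case False
    have "norm (F (- (- t))) \<le> c / K * exp (K * (- t))"
    proof (rule forward[where G = "\<lambda>s. F (- s)" and k = "\<lambda>s. - h (- s)"])
      show "norm (- h (- s)) \<le> c * exp (K * \<bar>s\<bar>)" for s
        using h[of "- s"] by simp
    qed (use False F0 F has_vector_derivative_reflect in auto)
    then show ?thesis using False by simp
  qed
qed

text \<open>Picard iteration is a contraction for the norm weighted by \<open>exp (- K * \<bar>t\<bar>)\<close>, so one
  application of the fixed point theorem gives a solution on the whole line.\<close>

lemma is_solution_exists:
  fixes f :: "'a::euclidean_space \<Rightarrow> 'a"
  assumes lip: "L-lipschitz_on UNIV f"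
  shows "\<exists>u. is_solution f x u"
proof -
  \<comment> \<open>This choice gives \<open>L / K \<le> 1/2\<close> and keeps \<open>K\<close>
    positive even for \<open>L = 0\<close>.\<close>
  define K where "K = 2 * L + 1"
  have L: "L \<ge> 0" and K: "K > 0" "L / K \<le> 1/2"
    using lipschitz_on_nonneg[OF lip] by (auto simp: K_def field_simps)
  have fc: "continuous_on UNIV f"
    using lip by (rule lipschitz_on_continuous_on)
  have f_dist: "norm (f a - f b) \<le> L * norm (a - b)" for a b
    using lipschitz_onD[OF lip] by (simp add: dist_norm)
  \<comment> \<open>A bounded continuous \<open>v\<close> encodes the curve
    \<open>x + exp (K * \<bar>s\<bar>) *\<^sub>R v s\<close>; \<open>h v\<close> is the vector field
    along that curve.\<close>
  define h where "h v s = f (x + exp (K * \<bar>s\<bar>) *\<^sub>R apply_bcontfun v s)" for v and s :: real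
  have hc: "continuous_on UNIV (h v)" for v
    unfolding h_def
    by (intro continuous_on_compose2[OF fc] continuous_intros) auto
  obtain P where P0: "\<And>v. P v 0 = 0"
    and P: "\<And>v t. (P v has_vector_derivative h v t) (at t)"
    using primitive_on_line[OF hc] by metis
  \<comment> \<open>\<open>x + P v\<close> is the Picard iterate; \<open>T v\<close> encodes it
    again as a bounded function.\<close>
  define T where "T v t = exp (- (K * \<bar>t\<bar>)) *\<^sub>R P v t" for v t
  have T_bcontfun: "T v \<in> bcontfun" for v
  proof (rule bcontfun_normI)
    have "continuous_on UNIV (P v)"
      using P by (meson continuous_at_imp_continuous_on has_vector_derivative_continuous)
    then show "continuous_on UNIV (T v)"
      unfolding T_def by (intro continuous_intros)
    show "norm (T v t) \<le> (norm (f x) + L * norm v) / K" for t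
    proof -
      have "norm (h v s) \<le> (norm (f x) + L * norm v) * exp (K * \<bar>s\<bar>)" for s
      proof -
        have "norm (h v s) \<le> norm (f x) + norm (h v s - f x)"
          by norm
        also have "norm (h v s - f x) \<le> L * (exp (K * \<bar>s\<bar>) * norm (apply_bcontfun v s))"
          using f_dist[of "x + exp (K * \<bar>s\<bar>) *\<^sub>R apply_bcontfun v s" x] by (simp add: h_def)
        also have "\<dots> \<le> L * (exp (K * \<bar>s\<bar>) * norm v)"
          using L by (intro mult_left_mono norm_bounded) auto
        also have "norm (f x) \<le> norm (f x) * exp (K * \<bar>s\<bar>)"
          using K by (simp add: mult_le_cancel_left1)
        finally show ?thesis by (simp add: algebra_simps)
      qed
      from norm_primitive_le_exp[OF P0 P this K(1), of t] show ?thesis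
        by (simp add: T_def exp_minus field_simps)
    qed
  qed
  have T_diff: "norm (T v t - T w t) \<le> 1/2 * dist v w" for v w t
  proof -
    have "norm (h v s - h w s) \<le> (L * dist v w) * exp (K * \<bar>s\<bar>)" for s
    proof -
      have "norm (h v s - h w s)
          \<le> L * (exp (K * \<bar>s\<bar>) * dist (apply_bcontfun v s) (apply_bcontfun w s))"
        unfolding h_def by (rule order_trans[OF f_dist])
          (simp add: dist_norm flip: scaleR_diff_right)
      also have "\<dots> \<le> L * (exp (K * \<bar>s\<bar>) * dist v w)"
        using L by (intro mult_left_mono dist_bounded) auto
      finally show ?thesis by (simp add: algebra_simps)
    qed
    then have "norm (P v t - P w t) \<le> L * dist v w / K * exp (K * \<bar>t\<bar>)"
      by (intro norm_primitive_le_exp[where h = "\<lambda>s. h v s - h w s"])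
        (auto simp: P0 K intro!: has_vector_derivative_diff P)
    then have "norm (P v t - P w t) / exp (K * \<bar>t\<bar>) \<le> L / K * dist v w"
      by (simp add: divide_le_eq)
    moreover have "norm (T v t - T w t) = norm (P v t - P w t) / exp (K * \<bar>t\<bar>)"
      unfolding T_def scaleR_diff_right[symmetric] by (simp add: exp_minus divide_inverse)
    ultimately have "norm (T v t - T w t) \<le> L / K * dist v w"
      by simp
    also have "\<dots> \<le> 1/2 * dist v w"
      using K by (intro mult_right_mono) auto
    finally show ?thesis .
  qed
  have "\<exists>!v. Bcontfun (T v) = v"
  proof (rule banach_fix_type[of "1/2"])
    show "\<forall>v w. dist (Bcontfun (T v)) (Bcontfun (T w)) \<le> 1 / 2 * dist v w"
      by (intro allI dist_bound)
        (use T_diff in \<open>simp add: Bcontfun_inverse T_bcontfun dist_norm\<close>)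
  qed auto
  then obtain v where v: "Bcontfun (T v) = v" by blast
  have "apply_bcontfun v = T v"
    using Bcontfun_inverse[OF T_bcontfun, of v] v by simp
  \<comment> \<open>At the fixed point the two weights cancel, which leaves the differential
    equation for \<open>x + P v\<close>.\<close>
  then have h_v: "h v s = f (x + P v s)" for s
    by (simp add: h_def T_def flip: exp_add)
  have "((\<lambda>s. x + P v s) has_vector_derivative f (x + P v t)) (at t)" for t
    using has_vector_derivative_add[OF has_vector_derivative_const[of x] P[of v t]]
    by (simp add: h_v)
  then show ?thesis
    by (intro exI[of _ "\<lambda>s. x + P v s"]) (simp add: is_solution_def P0)
qed

section \<open>Uniqueness and the group law of the flow\<close>

text \<open>Gronwall's argument: by Cauchy-Schwarz and the Lipschitz bound, the derivative of the
  squared distance is at most \<open>2 * L\<close> times that distance, so the weighted distance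
  \<open>E\<close> is nonincreasing; it vanishes at time 0.\<close>

lemma is_solution_unique_forward:
  fixes f :: "'a::real_inner \<Rightarrow> 'a"
  assumes lip: "L-lipschitz_on UNIV f" and u: "is_solution f x u" and w: "is_solution f x w"
    and "t \<ge> 0"
  shows "u t = w t"
proof -
  define E where "E s = (u s - w s) \<bullet> (u s - w s) * exp (- (2 * L * s))" for s
  define D where "D s = f (u s) - f (w s)" for s
  have du: "(u has_derivative (\<lambda>h. h *\<^sub>R f (u s))) (at s)"
    and dw: "(w has_derivative (\<lambda>h. h *\<^sub>R f (w s))) (at s)" for s
    using u w by (auto simp: is_solution_def has_vector_derivative_def)
  have "E t \<le> E 0"
  proof (rule DERIV_nonpos_imp_nonincreasing[OF \<open>t \<ge> 0\<close>])
    fix s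
    let ?y = "(2 * ((u s - w s) \<bullet> D s) - 2 * L * ((u s - w s) \<bullet> (u s - w s))) * exp (- (2 * L * s))"
    have "(E has_real_derivative ?y) (at s)"
      unfolding E_def has_field_derivative_def
      by (auto intro!: derivative_eq_intros du dw simp: fun_eq_iff D_def algebra_simps inner_commute)
    moreover have "(u s - w s) \<bullet> D s \<le> L * ((u s - w s) \<bullet> (u s - w s))"
    proof -
      have "(u s - w s) \<bullet> D s \<le> norm (u s - w s) * norm (D s)"
        by (rule norm_cauchy_schwarz)
      also have "\<dots> \<le> norm (u s - w s) * (L * norm (u s - w s))"
        using lipschitz_onD[OF lip, of "u s" "w s"]
        by (intro mult_left_mono) (auto simp: dist_norm D_def)
      finally show ?thesis by (simp add: dot_square_norm power2_eq_square algebra_simps)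
    qed
    ultimately show "\<exists>y. (E has_real_derivative y) (at s) \<and> y \<le> 0"
      by (intro exI[of _ ?y]) (simp add: mult_le_0_iff)
  qed
  moreover have "E 0 = 0"
    using u w by (simp add: E_def is_solution_def)
  ultimately have "(u t - w t) \<bullet> (u t - w t) \<le> 0"
    by (simp add: E_def mult_le_0_iff)
  then show ?thesis
    using inner_ge_zero[of "u t - w t"] by (metis antisym inner_eq_zero_iff right_minus_eq)
qed

lemma is_solution_reflect:
  assumes "is_solution f x u"
  shows "is_solution (\<lambda>y. - f y) x (\<lambda>t. u (- t))"
proof -
  have "((\<lambda>t. u (- t)) has_vector_derivative - f (u (- t))) (at t)" for t
    using assms by (intro has_vector_derivative_reflect) (simp add: is_solution_def)
  then show ?thesis
    using assms by (simp add: is_solution_def)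
qed

lemma is_solution_unique:
  fixes f :: "'a::real_inner \<Rightarrow> 'a"
  assumes lip: "L-lipschitz_on UNIV f" and u: "is_solution f x u" and w: "is_solution f x w"
  shows "u = w"
proof
  fix t
  show "u t = w t"
  proof (cases "t \<ge> 0")
    case True
    then show ?thesis using is_solution_unique_forward[OF lip u w] by simp
  next
    case False
    \<comment> \<open>The reversed field has the same Lipschitz constant, so uniqueness in the past
      is uniqueness in the future for the reflected solutions.\<close>
    have "L-lipschitz_on UNIV (\<lambda>y. - f y)"
      using lip by (simp add: lipschitz_on_def dist_minus)
    from is_solution_unique_forward[OF this is_solution_reflect[OF u] is_solution_reflect[OF w], of "- t"]
    show ?thesis using False by simp
  qed
qed

text \<open>Existence and uniqueness together give the definite description in \<open>flow\<close>
  its meaning.\<close>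

lemma is_solution_flow:
  fixes f :: "'a::euclidean_space \<Rightarrow> 'a"
  assumes "L-lipschitz_on UNIV f"
  shows "is_solution f x (flow f x)"
proof -
  obtain u where u: "is_solution f x u"
    using is_solution_exists[OF assms] by blast
  show ?thesis
    unfolding flow_def by (rule theI[of "is_solution f x", OF u]) (rule is_solution_unique[OF assms _ u])
qed

lemma flow_0:
  fixes f :: "'a::euclidean_space \<Rightarrow> 'a"
  assumes "L-lipschitz_on UNIV f"
  shows "flow f x 0 = x"
  using is_solution_flow[OF assms] by (simp add: is_solution_def)

text \<open>The equation is autonomous: a solution shifted in time is again a solution, and
  uniqueness identifies it.\<close>

lemma flow_add:
  fixes f :: "'a::euclidean_space \<Rightarrow> 'a"
  assumes lip: "L-lipschitz_on UNIV f"
  shows "flow f x (s + t) = flow f (flow f x s) t"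
proof -
  have "((\<lambda>t. flow f x (s + t)) has_vector_derivative f (flow f x (s + t))) (at t)" for t
  proof -
    have "((flow f x \<circ> (\<lambda>t. s + t)) has_vector_derivative 1 *\<^sub>R f (flow f x (s + t))) (at t)"
      using is_solution_flow[OF lip, of x]
      by (intro vector_diff_chain_at) (auto simp: is_solution_def intro!: derivative_eq_intros)
    then show ?thesis by (simp add: o_def)
  qed
  then have "is_solution f (flow f x s) (\<lambda>t. flow f x (s + t))"
    by (simp add: is_solution_def)
  from is_solution_unique[OF lip this is_solution_flow[OF lip]] show ?thesis
    by metis
qed

section \<open>Delayed executions\<close>

text \<open>Connected sets of reals are intervals, so measure and diameter of a component agree.
  This trades the measure of components for plain inequalities between times.\<close>

lemma components_emeasure_le_iff:
  fixes S :: "real set"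
  assumes "H \<ge> 0"
  shows "(\<forall>C\<in>components S. emeasure lborel C \<le> ennreal H) \<longleftrightarrow>
    (\<forall>a b. a \<le> b \<longrightarrow> {a..b} \<subseteq> S \<longrightarrow> b - a \<le> H)" (is "?L \<longleftrightarrow> ?R")
proof
  assume L: ?L
  show ?R
  proof (intro allI impI)
    fix a b assume ab: "a \<le> b" "{a..b} \<subseteq> S"
    let ?C = "connected_component_set S a"
    have "{a..b} \<subseteq> ?C"
      using ab by (intro connected_component_maximal) auto
    moreover have "?C \<in> components S"
      using ab by (auto simp: components_def)
    \<comment> \<open>Monotonicity of the measure asks for measurability of the larger set.\<close>
    moreover have "?C \<in> sets lborel"
      using real_interval_borel_measurable[of ?C] by (simp add: is_interval_connected_1)
    ultimately have "emeasure lborel {a..b} \<le> ennreal H"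
      using L emeasure_mono order_trans by meson
    then show "b - a \<le> H"
      using ab assms by (simp add: ennreal_le_iff)
  qed
next
  assume R: ?R
  show ?L
  proof
    fix C assume C: "C \<in> components S"
    then have "C \<noteq> {}" "C \<subseteq> S" "connected C"
      by (auto simp: in_components_nonempty in_components_subset in_components_connected)
    have diam: "b - a \<le> H" if "a \<in> C" "b \<in> C" for a b
    proof (cases "a \<le> b")
      case True
      have "{a..b} \<subseteq> C"
        using \<open>connected C\<close> that by (rule connected_contains_Icc)
      then show ?thesis using R True \<open>C \<subseteq> S\<close> by blast
    qed (use assms in simp)
    obtain c where "c \<in> C" using \<open>C \<noteq> {}\<close> by blast
    have bdd: "bdd_above C" "bdd_below C"
      using diam[OF \<open>c \<in> C\<close>] diam[OF _ \<open>c \<in> C\<close>]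
      by (auto intro!: bdd_aboveI[of _ "c + H"] bdd_belowI[of _ "c - H"] simp: algebra_simps)
    have "Sup C \<le> Inf C + H"
    proof (rule cSup_least[OF \<open>C \<noteq> {}\<close>])
      fix b assume "b \<in> C"
      then have "b - H \<le> Inf C"
        using diam by (intro cInf_greatest[OF \<open>C \<noteq> {}\<close>]) (auto simp: algebra_simps)
      then show "b \<le> Inf C + H" by simp
    qed
    moreover have "Inf C \<le> Sup C"
      using cInf_le_cSup[OF \<open>C \<noteq> {}\<close> bdd] .
    moreover have "C \<subseteq> {Inf C..Sup C}"
      using bdd by (auto intro: cInf_lower cSup_upper)
    then have "emeasure lborel C \<le> emeasure lborel {Inf C..Sup C}"
      by (intro emeasure_mono) auto
    moreover have "emeasure lborel {Inf C..Sup C} = ennreal (Sup C - Inf C)"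
      using \<open>Inf C \<le> Sup C\<close> by simp
    moreover have "ennreal (Sup C - Inf C) \<le> ennreal H"
      using \<open>Sup C \<le> Inf C + H\<close> by (intro ennreal_leI) simp
    ultimately show "emeasure lborel C \<le> ennreal H"
      by (metis order_trans)
  qed
qed

text \<open>The setting of the contradiction: \<open>attractive\<close> is the convergence clause of
  GAS, to be applied to the periodic trajectories built from a loop.\<close>

locale attractive_delayed_automaton =
  fixes g :: "'a::euclidean_space \<Rightarrow> real" and f :: "mode \<Rightarrow> 'a \<Rightarrow> 'a" and H :: real and xs :: 'a
  assumes lipschitz: "\<exists>L. L-lipschitz_on UNIV (f q)"
    and H_nonneg: "H \<ge> 0"
    and attractive: "trajectory g f H T \<Longrightarrow> defined_for_all_future T \<Longrightarrow> converges_to T xs"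
begin

lemma flow_zero [simp]: "flow (f q) y 0 = y"
  using flow_0 lipschitz by blast

lemma flow_plus: "flow (f q) y (s + s') = flow (f q) (flow (f q) y s) s'"
  using flow_add lipschitz by blast

text \<open>Time is counted from the start of the piece, so that pieces can be cut, glued and
  repeated without regard to absolute times.\<close>

definition delay_bounded :: "mode \<Rightarrow> 'a \<Rightarrow> real \<Rightarrow> bool" where
  "delay_bounded q y d \<longleftrightarrow> (\<forall>a b. 0 \<le> a \<longrightarrow> a \<le> b \<longrightarrow> b \<le> d \<longrightarrow>
     (\<forall>s\<in>{a..b}. flow (f q) y s \<notin> mode_dom g q) \<longrightarrow> b - a \<le> H)"

lemma delay_boundedD:
  "\<lbrakk>delay_bounded q y d; 0 \<le> a; a \<le> b; b \<le> d; \<And>s. a \<le> s \<Longrightarrow> s \<le> b \<Longrightarrow> flow (f q) y s \<notin> mode_dom g q\<rbrakk>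
    \<Longrightarrow> b - a \<le> H"
  by (simp add: delay_bounded_def)

lemma emeasure_components_iff_delay:
  "(\<forall>C\<in>components {s \<in> mode_interval t j. piece_state f t q x j s \<notin> mode_dom g (q j)}.
      emeasure lborel C \<le> ennreal H) \<longleftrightarrow>
   (\<forall>a b. a \<le> b \<longrightarrow> t j \<le> ereal a \<longrightarrow> ereal b \<le> t (Suc j) \<longrightarrow>
      (\<forall>s\<in>{a..b}. piece_state f t q x j s \<notin> mode_dom g (q j)) \<longrightarrow> b - a \<le> H)"
proof -
  have "{a..b} \<subseteq> {s \<in> mode_interval t j. piece_state f t q x j s \<notin> mode_dom g (q j)} \<longleftrightarrow>
      t j \<le> ereal a \<and> ereal b \<le> t (Suc j) \<and>
      (\<forall>s\<in>{a..b}. piece_state f t q x j s \<notin> mode_dom g (q j))" if "a \<le> b" for a b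
  proof -
    have "t j \<le> ereal s \<and> ereal s \<le> t (Suc j)"
      if "t j \<le> ereal a" "ereal b \<le> t (Suc j)" "a \<le> s" "s \<le> b" for s
      using that by (meson ereal_less_eq(3) order_trans)
    then show ?thesis
      using \<open>a \<le> b\<close> by (auto simp: subset_iff mode_interval_def)
  qed
  then show ?thesis
    unfolding components_emeasure_le_iff[OF H_nonneg] by blast
qed

section \<open>Periodic trajectories rest at the equilibrium\<close>

lemma flow_period:
  assumes "flow (f q) y P = y"
  shows "flow (f q) y (real n * P + s) = flow (f q) y s"
proof (induction n)
  case (Suc n)
  have "flow (f q) y (real (Suc n) * P + s) = flow (f q) y (P + (real n * P + s))"
    by (simp add: algebra_simps)
  also have "\<dots> = flow (f q) y (real n * P + s)"
    by (simp only: flow_plus[of q y P] assms)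
  finally show ?case using Suc by simp
qed simp

text \<open>The loop is repeated forever as a single piece. An excursion from the domain cannot pass
  a multiple of \<open>P\<close>, where the state is \<open>y\<close>, so it fits into one period
  and obeys the delay bound. Every state recurs arbitrarily late, so convergence forces it to be
  \<open>xs\<close>.\<close>

lemma periodic_flow_eq_xs:
  assumes dom: "y \<in> mode_dom g q" and delay: "delay_bounded q y P"
    and P: "P > 0" "flow (f q) y P = y" and "s \<ge> 0"
  shows "flow (f q) y s = xs"
proof -
  \<comment> \<open>The value \<open>t 1 = \<infinity>\<close> makes the only piece last
    forever.\<close>
  define t where "t j = (if j = 0 then 0 else \<infinity> :: ereal)" for j :: nat
  define T where "T = {(q, s, flow (f q) y s) | s. s \<ge> 0}"
  have "execution g f H 1 t (\<lambda>_. q) (\<lambda>_. y)"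
    unfolding execution_def
  proof (intro conjI allI impI)
    fix j assume "enat j < 1"
    then have [simp]: "j = 0" by (simp add: one_enat_def)
    show "\<forall>C\<in>components {s \<in> mode_interval t j. piece_state f t (\<lambda>_. q) (\<lambda>_. y) j s \<notin> mode_dom g q}.
        emeasure lborel C \<le> ennreal H"
      unfolding emeasure_components_iff_delay[where q = "\<lambda>_. q"]
    proof (intro allI impI)
      fix a b
      assume ab: "a \<le> b" "t j \<le> ereal a"
        and out: "\<forall>s\<in>{a..b}. piece_state f t (\<lambda>_. q) (\<lambda>_. y) j s \<notin> mode_dom g q"
      \<comment> \<open>\<open>n\<close> counts the full periods completed before
        \<open>a\<close>.\<close>
      define n where "n = nat \<lfloor>a / P\<rfloor>"
      have "0 \<le> a / P" using ab P by (simp add: t_def)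
      then have "real n \<le> a / P" "a / P < real n + 1"
        unfolding n_def by linarith+
      then have n: "real n * P \<le> a" "a < real n * P + P"
        using P by (auto simp: field_simps)
      have out': "flow (f q) y s \<notin> mode_dom g q" if "a - real n * P \<le> s" "s \<le> b - real n * P" for s
        using out[rule_format, of "real n * P + s"] that
        by (simp add: piece_state_def t_def flow_period[OF P(2)])
      \<comment> \<open>Otherwise the excursion would contain the next return to \<open>y\<close>,
        which lies in the domain.\<close>
      have "b - real n * P < P"
        using out'[of P] n P dom by force
      then show "b - a \<le> H"
        using delay_boundedD[OF delay, of "a - real n * P" "b - real n * P"] n ab out' by simp
    qed
  qed (use dom in \<open>auto simp: t_def one_enat_def enat_0_iff\<close>)
  moreover have "T = (\<Union>j\<in>{j. enat j < 1}.
      {(q, s, piece_state f t (\<lambda>_. q) (\<lambda>_. y) j s) | s. s \<in> mode_interval t j})"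
  proof -
    have "{j. enat j < 1} = {0}" by (auto simp: one_enat_def)
    then show ?thesis
      by (auto simp: T_def piece_state_def t_def mode_interval_def)
  qed
  ultimately have "trajectory g f H T"
    unfolding trajectory_def by blast
  moreover have "defined_for_all_future T"
    unfolding defined_for_all_future_def
  proof
    fix M
    show "\<exists>(q, t, x)\<in>T. M \<le> t"
      by (intro bexI[of _ "(q, max 0 M, flow (f q) y (max 0 M))"]) (auto simp: T_def)
  qed
  ultimately have conv: "converges_to T xs" by (rule attractive)
  have "dist (flow (f q) y s) xs < \<epsilon>" if \<epsilon>: "\<epsilon> > 0" for \<epsilon>
  proof -
    obtain M where M: "\<forall>(q, t, x) \<in> T. M \<le> t \<longrightarrow> dist x xs < \<epsilon>"
      using conv \<epsilon> unfolding converges_to_def by blast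
    obtain n where "M / P \<le> real n" using real_arch_simple by blast
    then have "M \<le> real n * P + s" using P \<open>s \<ge> 0\<close> by (simp add: field_simps)
    moreover have "(q, real n * P + s, flow (f q) y (real n * P + s)) \<in> T"
      using P \<open>s \<ge> 0\<close> by (auto simp: T_def)
    ultimately have "dist (flow (f q) y (real n * P + s)) xs < \<epsilon>"
      using M by blast
    then show ?thesis by (simp add: flow_period[OF P(2)])
  qed
  then show ?thesis
    by (metis dist_pos_lt less_irrefl)
qed

text \<open>The counterpart with switches: a sequence of pieces that repeats after \<open>m\<close>
  indices is an infinite execution, and each of its states recurs at arbitrarily late times.\<close>

lemma periodic_execution_eq_xs:
  fixes d :: "nat \<Rightarrow> real"
  assumes m: "m > 0"
    and period: "\<And>k. d (k + m) = d k" "\<And>k. x (k + m) = x k" "\<And>k. q (k + m) = q k"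
    and d_pos: "\<And>k. d k > 0"
    and dom: "\<And>k. x k \<in> mode_dom g (q k)"
    and switch: "\<And>k. q (Suc k) \<noteq> q k"
    and step: "\<And>k. x (Suc k) = flow (f (q k)) (x k) (d k)"
    and delay: "\<And>k. delay_bounded (q k) (x k) (d k)"
    and s: "0 \<le> s" "s \<le> d k"
  shows "flow (f (q k)) (x k) s = xs"
proof -
  \<comment> \<open>\<open>r k\<close> is the starting time of piece \<open>k\<close>.\<close>
  define r where "r k = (\<Sum>i<k. d i)" for k
  have r_Suc: "r (Suc k) = r k + d k" for k
    by (simp add: r_def)
  have d_mod: "d k = d (k mod m)" for k
  proof -
    have "d (i + n * m) = d i" for i n
      by (induction n) (simp_all add: period(1) flip: add.assoc add.commute[of "_ * m" m])
    from this[of "k mod m" "k div m"] show ?thesis by simp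
  qed
  \<comment> \<open>The shortest of the \<open>m\<close> durations bounds all of them from below, so
    the switching times cannot accumulate.\<close>
  define \<delta> where "\<delta> = Min (d ` {..<m})"
  have \<delta>_pos: "\<delta> > 0"
    using m d_pos by (auto simp: \<delta>_def lessThan_empty_iff)
  have \<delta>_le: "\<delta> \<le> d k" for k
    using m d_mod[of k] by (auto simp: \<delta>_def intro!: Min_le)
  have r_ge: "r k \<ge> real k * \<delta>" for k
  proof (induction k)
    case (Suc k)
    then show ?case using \<delta>_le[of k] by (simp add: r_Suc algebra_simps)
  qed (simp add: r_def)
  have r_unbounded: "\<exists>k0. \<forall>k\<ge>k0. M \<le> r k" for M
  proof -
    obtain n where n: "M / \<delta> \<le> real n" using real_arch_simple by blast
    have "M \<le> r k" if "k \<ge> n" for k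
    proof -
      have "M \<le> real n * \<delta>" using n \<delta>_pos by (simp add: field_simps)
      also have "\<dots> \<le> real k * \<delta>" using that \<delta>_pos by simp
      finally show ?thesis using r_ge[of k] by simp
    qed
    then show ?thesis by blast
  qed
  define t where "t k = ereal (r k)" for k
  define T where "T = (\<Union>j\<in>{j. enat j < \<infinity>}. {(q j, s, piece_state f t q x j s) | s. s \<in> mode_interval t j})"
  have in_T: "(q k, r k + s, flow (f (q k)) (x k) s) \<in> T" if "0 \<le> s" "s \<le> d k" for k s
    using that by (auto simp: T_def piece_state_def mode_interval_def t_def r_Suc
        intro!: exI[of _ k] exI[of _ "r k + s"])
  have "execution g f H \<infinity> t q x"
    unfolding execution_def
  proof (intro conjI allI impI)
    show "t \<longlonglongrightarrow> \<infinity>"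
      unfolding t_def tendsto_PInfty eventually_sequentially
    proof
      fix B :: real
      obtain k0 where "\<forall>k\<ge>k0. B + 1 \<le> r k" using r_unbounded by blast
      then show "\<exists>N. \<forall>n\<ge>N. ereal B < ereal (r n)" by (intro exI[of _ k0]) force
    qed
    show "g (x (Suc j)) \<ge> 0" if "q j = Mode1 \<and> q (Suc j) = Mode2" for j
      using dom[of "Suc j"] that by simp
    show "g (x (Suc j)) \<le> 0" if "q j = Mode2 \<and> q (Suc j) = Mode1" for j
      using dom[of "Suc j"] that by simp
    show "\<forall>C\<in>components {s \<in> mode_interval t j. piece_state f t q x j s \<notin> mode_dom g (q j)}.
        emeasure lborel C \<le> ennreal H" for j
      unfolding emeasure_components_iff_delay
    proof (intro allI impI)
      fix a b
      assume ab: "a \<le> b" "t j \<le> ereal a" "ereal b \<le> t (Suc j)"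
        and out: "\<forall>s\<in>{a..b}. piece_state f t q x j s \<notin> mode_dom g (q j)"
      have "flow (f (q j)) (x j) s \<notin> mode_dom g (q j)" if "a - r j \<le> s" "s \<le> b - r j" for s
        using out[rule_format, of "r j + s"] that by (simp add: piece_state_def t_def)
      then show "b - a \<le> H"
        using delay_boundedD[OF delay[of j], of "a - r j" "b - r j"] ab by (simp add: t_def r_Suc)
    qed
  qed (use dom switch step d_pos in \<open>auto simp: t_def r_Suc piece_state_def\<close>)
  then have "trajectory g f H T"
    unfolding trajectory_def T_def by blast
  moreover have "defined_for_all_future T"
    unfolding defined_for_all_future_def
  proof
    fix M
    obtain k where "M \<le> r k" using r_unbounded by blast
    then show "\<exists>(q, t, x)\<in>T. M \<le> t"
      using in_T[of 0 k] d_pos[of k] by (intro bexI[of _ "(q k, r k, x k)"]) auto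
  qed
  ultimately have conv: "converges_to T xs" by (rule attractive)
  have "dist (flow (f (q k)) (x k) s) xs < \<epsilon>" if \<epsilon>: "\<epsilon> > 0" for \<epsilon>
  proof -
    obtain M where M: "\<forall>(q, t, x) \<in> T. M \<le> t \<longrightarrow> dist x xs < \<epsilon>"
      using conv \<epsilon> unfolding converges_to_def by blast
    obtain n where n: "\<forall>i\<ge>n. M \<le> r i" using r_unbounded by blast
    have shift: "d (k + i * m) = d k" "x (k + i * m) = x k" "q (k + i * m) = q k" for i
      by (induction i) (simp_all add: period flip: add.assoc add.commute[of "_ * m" m])
    \<comment> \<open>Since \<open>m\<close> is positive, \<open>n\<close> repetitions advance the
      index by at least \<open>n\<close>, hence the time beyond \<open>M\<close>.\<close>
    have "k + n * m \<ge> n" using m by (simp add: trans_le_add2)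
    with n have "M \<le> r (k + n * m)" by blast
    then have "M \<le> r (k + n * m) + s" using s by simp
    moreover have "(q k, r (k + n * m) + s, flow (f (q k)) (x k) s) \<in> T"
      using in_T[of s "k + n * m"] s by (simp add: shift)
    ultimately show ?thesis using M by blast
  qed
  then show ?thesis
    by (metis dist_pos_lt less_irrefl)
qed

section \<open>Times, switches and delays of an execution\<close>

lemma execution_less_Suc:
  assumes "execution g f H J t q x" "enat j < J"
  shows "t j < t (Suc j)"
  using assms by (simp add: execution_def)

lemma execution_finite_time:
  assumes ex: "execution g f H J t q x" and j: "enat j < J"
  shows "ereal (real_of_ereal (t j)) = t j"
proof -
  have "t j \<noteq> \<infinity>"
    using execution_less_Suc[OF ex j] by auto
  moreover have "t j \<noteq> -\<infinity>"
  proof (cases j)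
    case 0
    then show ?thesis using ex by (simp add: execution_def)
  next
    case (Suc i)
    then have "enat i < J"
      using j by (metis enat_ord_simps(2) lessI less_trans)
    from execution_less_Suc[OF ex this] show ?thesis using Suc by auto
  qed
  ultimately show ?thesis by (auto simp: ereal_real)
qed

lemma execution_mono:
  assumes ex: "execution g f H J t q x" and "i \<le> j" "enat j \<le> J"
  shows "t i \<le> t j"
  using \<open>i \<le> j\<close> \<open>enat j \<le> J\<close>
proof (induction j rule: dec_induct)
  case (step n)
  then have "enat n < J"
    by (metis Suc_ile_eq)
  then have "t i \<le> t n" "t n < t (Suc n)"
    using step.IH execution_less_Suc[OF ex] by simp_all
  then show ?case by simp
qed simp

text \<open>Consecutive intervals share an endpoint, so only strictly ordered times determine the
  order of the pieces.\<close>

lemma execution_index_le: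
  assumes ex: "execution g f H J t q x" and i: "enat i < J"
    and s: "s \<in> mode_interval t i" "s' \<in> mode_interval t j" "s < s'"
  shows "i \<le> j"
proof (rule ccontr)
  assume "\<not> i \<le> j"
  then have "t (Suc j) \<le> t i"
    using i by (intro execution_mono[OF ex]) auto
  moreover have "ereal s' \<le> t (Suc j)" "t i \<le> ereal s"
    using s by (simp_all add: mode_interval_def)
  ultimately have "ereal s' \<le> ereal s"
    by (meson order_trans)
  then show False using s by simp
qed

lemma execution_start_in_dom:
  assumes ex: "execution g f H J t q x" and j: "enat j < J"
  shows "x j \<in> mode_dom g (q j)"
proof (cases j)
  case 0
  then show ?thesis using ex by (simp add: execution_def)
next
  case (Suc i)
  with ex j have "q j \<noteq> q i \<and> (q i = Mode1 \<and> q j = Mode2 \<longrightarrow> g (x j) \<ge> 0) \<and>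
      (q i = Mode2 \<and> q j = Mode1 \<longrightarrow> g (x j) \<le> 0)"
    unfolding execution_def by blast
  \<comment> \<open>With two modes, \<open>q j \<noteq> q i\<close> leaves exactly the two guarded
    transitions.\<close>
  then show ?thesis
    by (cases "q i"; cases "q j") simp_all
qed

lemma execution_switch:
  assumes "execution g f H J t q x" "enat (Suc j) < J"
  shows "q (Suc j) \<noteq> q j" and "x (Suc j) = piece_state f t q x j (real_of_ereal (t (Suc j)))"
  using assms unfolding execution_def by blast+

text \<open>The duration \<open>d\<close> is kept apart from the end of the piece in order to cover
  initial segments, also those of an unbounded last piece.\<close>

lemma execution_delay_bounded:
  assumes ex: "execution g f H J t q x" and j: "enat j < J"
    and d: "ereal (real_of_ereal (t j) + d) \<le> t (Suc j)"
  shows "delay_bounded (q j) (x j) d"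
  unfolding delay_bounded_def
proof (intro allI impI)
  fix a b
  assume ab: "0 \<le> a" "a \<le> b" "b \<le> d" and out: "\<forall>s\<in>{a..b}. flow (f (q j)) (x j) s \<notin> mode_dom g (q j)"
  let ?t = "real_of_ereal (t j)"
  have "\<forall>C\<in>components {s \<in> mode_interval t j. piece_state f t q x j s \<notin> mode_dom g (q j)}.
      emeasure lborel C \<le> ennreal H"
    using ex j unfolding execution_def by blast
  then have bound: "b - a \<le> H" if "a \<le> b" "t j \<le> ereal a" "ereal b \<le> t (Suc j)"
      "\<forall>s\<in>{a..b}. piece_state f t q x j s \<notin> mode_dom g (q j)" for a b
    using that unfolding emeasure_components_iff_delay by blast
  have "(?t + b) - (?t + a) \<le> H"
  proof (rule bound)
    have "ereal ?t \<le> ereal (?t + a)"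
      using ab by simp
    then show "t j \<le> ereal (?t + a)"
      by (simp only: execution_finite_time[OF ex j])
    show "ereal (?t + b) \<le> t (Suc j)"
      using ab by (intro order_trans[OF _ d]) simp
    show "\<forall>s\<in>{?t + a..?t + b}. piece_state f t q x j s \<notin> mode_dom g (q j)"
      using out by (simp add: piece_state_def)
  qed (use ab in simp)
  then show "b - a \<le> H" by simp
qed

text \<open>The flow is invertible and a piece starts in the domain of its mode, so a loop within one
  piece extends backwards to the start of that piece.\<close>

lemma loop_in_piece_eq_xs:
  assumes ex: "execution g f H J t q x" and j: "enat j < J"
    and int: "t0 \<in> mode_interval t j" "t2 \<in> mode_interval t j" "s \<in> mode_interval t j"
    and "t0 < t2"
    and loop: "piece_state f t q x j t0 = piece_state f t q x j t2"
  shows "piece_state f t q x j s = xs"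
proof -
  define r where "r = real_of_ereal (t j)"
  have t: "t j = ereal r"
    using execution_finite_time[OF ex j] by (simp add: r_def)
  have ge: "r \<le> t0" "r \<le> s" and le: "ereal t2 \<le> t (Suc j)"
    using int by (auto simp: mode_interval_def t)
  \<comment> \<open>The common state at \<open>t0\<close> and \<open>t2\<close> is moved back by
    \<open>t0 - r\<close>; from \<open>t0\<close> this leads to \<open>x j\<close>.\<close>
  have "flow (f (q j)) (x j) (t2 - t0) = flow (f (q j)) (x j) ((t2 - r) + (r - t0))"
    by simp
  also have "\<dots> = flow (f (q j)) (flow (f (q j)) (x j) (t0 - r)) (r - t0)"
    using loop by (simp only: flow_plus piece_state_def r_def)
  also have "\<dots> = flow (f (q j)) (x j) ((t0 - r) + (r - t0))"
    by (simp only: flow_plus)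
  finally have "flow (f (q j)) (x j) (t2 - t0) = x j"
    by simp
  moreover have "ereal (r + (t2 - t0)) \<le> t (Suc j)"
    using ge by (intro order_trans[OF _ le]) simp
  then have "delay_bounded (q j) (x j) (t2 - t0)"
    by (intro execution_delay_bounded[OF ex j]) (simp add: t)
  ultimately have "flow (f (q j)) (x j) (s - r) = xs"
    using \<open>t0 < t2\<close> ge
    by (intro periodic_flow_eq_xs[OF execution_start_in_dom[OF ex j], of "t2 - t0"]) simp_all
  then show ?thesis by (simp add: piece_state_def r_def)
qed

text \<open>An interval outside the domain cannot contain the start of either piece, so it lies within
  one of them.\<close>

lemma delay_bounded_glue:
  assumes delay: "delay_bounded q y a" "delay_bounded q y' (a' + b)"
    and start: "y' \<in> mode_dom g q"
    and glue: "flow (f q) y a = flow (f q) y' a'"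
    and nonneg: "0 \<le> a'" "0 \<le> b"
  shows "delay_bounded q y (a + b)"
  unfolding delay_bounded_def
proof (intro allI impI)
  fix c d
  assume cd: "0 \<le> c" "c \<le> d" "d \<le> a + b" and out: "\<forall>s\<in>{c..d}. flow (f q) y s \<notin> mode_dom g q"
  have eq: "flow (f q) y s = flow (f q) y' (s - (a - a'))" for s
  proof -
    have "flow (f q) y s = flow (f q) y (a + (s - a))" by simp
    also have "\<dots> = flow (f q) y' (a' + (s - a))"
      by (simp only: flow_plus glue)
    also have "a' + (s - a) = s - (a - a')" by simp
    finally show ?thesis .
  qed
  \<comment> \<open>On the clock of \<open>y\<close>, the flow line passes \<open>y'\<close> at the
    possibly negative time \<open>a - a'\<close>.\<close>
  have "a - a' \<notin> {c..d}"
    using out eq[of "a - a'"] start by auto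
  then consider "d \<le> a" | "a - a' \<le> c"
    using nonneg by (meson atLeastAtMost_iff diff_le_eq le_add_same_cancel1 linear order_trans)
  then show "d - c \<le> H"
  proof cases
    case 1
    then show ?thesis using delay_boundedD[OF delay(1) cd(1,2)] out by simp
  next
    case 2
    have "flow (f q) y' s \<notin> mode_dom g q" if "c - (a - a') \<le> s" "s \<le> d - (a - a')" for s
      using out[rule_format, of "s + (a - a')"] eq[of "s + (a - a')"] that by auto
    then show ?thesis
      using delay_boundedD[OF delay(2), of "c - (a - a')" "d - (a - a')"] cd 2 by simp
  qed
qed

section \<open>Loops across several pieces\<close>

text \<open>The periodic execution cycles through the pieces \<open>Suc j0\<close> to
  \<open>j2\<close>; the last one, cut at \<open>t2\<close>, is continued by the rest of piece
  \<open>j0\<close> after \<open>t0\<close>. The assumption \<open>pos\<close> gives the glued piece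
  positive length.\<close>

lemma loop_eq_xs:
  assumes ex: "execution g f H J t q x" and j2: "enat j2 < J" and "j0 < j2" and mode: "q j0 = q j2"
    and t0: "t0 \<in> mode_interval t j0" and t2: "t2 \<in> mode_interval t j2"
    and loop: "piece_state f t q x j0 t0 = piece_state f t q x j2 t2"
    and pos: "t0 < real_of_ereal (t (Suc j0)) \<or> real_of_ereal (t j2) < t2"
    and j: "j0 \<le> j" "j \<le> j2" and s: "s \<in> mode_interval t j" "t0 \<le> s" "s \<le> t2"
  shows "piece_state f t q x j s = xs"
proof -
  define r where "r i = real_of_ereal (t i)" for i
  have J: "enat i < J" if "i \<le> j2" for i
    using that j2 by (metis enat_ord_simps(1) le_less_trans)
  have t_eq: "t i = ereal (r i)" if "i \<le> j2" for i
    unfolding r_def using execution_finite_time[OF ex J[OF that]] by simp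
  have r_less: "r i < r (Suc i)" if "i < j2" for i
    using execution_less_Suc[OF ex J, of i] that t_eq by simp
  \<comment> \<open>\<open>a\<close> and \<open>a'\<close> are the times spent in pieces
    \<open>j2\<close> and \<open>j0\<close> before the common state, \<open>b\<close> the time left
    in piece \<open>j0\<close> after it.\<close>
  define a where "a = t2 - r j2"
  define a' where "a' = t0 - r j0"
  define b where "b = r (Suc j0) - t0"
  have nonneg: "0 \<le> a" "0 \<le> a'" "0 \<le> b"
    using t0 t2 \<open>j0 < j2\<close> by (auto simp: mode_interval_def t_eq a_def a'_def b_def)
  have le_t2: "ereal t2 \<le> t (Suc j2)"
    using t2 by (simp add: mode_interval_def)
  have glue: "flow (f (q j2)) (x j2) a = flow (f (q j2)) (x j0) a'"
    using loop by (simp add: piece_state_def r_def a_def a'_def mode)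
  define m where "m = j2 - j0"
  have m: "m > 0" using \<open>j0 < j2\<close> by (simp add: m_def)
  \<comment> \<open>The cycle begins with \<open>Suc j0\<close>, since piece \<open>j0\<close> only
    survives as the tail of the glued piece.\<close>
  define idx where "idx k = Suc j0 + k mod m" for k
  have idx_range: "j0 < idx k" "idx k \<le> j2" for k
    using mod_less_divisor[OF m, of k] unfolding idx_def m_def by linarith+
  have idx_period: "idx (k + m) = idx k" for k
    by (simp add: idx_def)
  have idx_Suc: "idx (Suc k) = (if idx k = j2 then Suc j0 else Suc (idx k))" for k
    using m by (auto simp: idx_def mod_Suc m_def)
  have idx_surj: "\<exists>k. idx k = i" if "j0 < i" "i \<le> j2" for i
    using that by (intro exI[of _ "i - Suc j0"]) (auto simp: idx_def m_def)
  define d where "d i = (if i = j2 then a + b else r (Suc i) - r i)" for i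
  have delay_d: "delay_bounded (q i) (x i) (d i)" if "j0 < i" "i \<le> j2" for i
  proof (cases "i = j2")
    case True
    have "delay_bounded (q j2) (x j2) (a + b)"
    proof (rule delay_bounded_glue)
      show "delay_bounded (q j2) (x j2) a"
        using le_t2 by (intro execution_delay_bounded[OF ex j2]) (simp add: a_def r_def)
      show "delay_bounded (q j2) (x j0) (a' + b)"
        using \<open>j0 < j2\<close> t_eq[of "Suc j0"]
        by (subst mode[symmetric], intro execution_delay_bounded[OF ex J])
          (simp_all add: a'_def b_def flip: r_def)
      show "x j0 \<in> mode_dom g (q j2)"
        using execution_start_in_dom[OF ex J, of j0] \<open>j0 < j2\<close> mode by simp
    qed (use glue nonneg in auto)
    then show ?thesis by (simp add: True d_def)
  next
    case False
    then show ?thesis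
      using that t_eq[of "Suc i"] by (intro execution_delay_bounded[OF ex J]) (auto simp: d_def simp flip: r_def)
  qed
  have on_loop: "flow (f (q i)) (x i) \<sigma> = xs" if i: "j0 < i" "i \<le> j2" and \<sigma>: "0 \<le> \<sigma>" "\<sigma> \<le> d i" for i \<sigma>
  proof -
    obtain k where k: "idx k = i" using idx_surj[OF i] by blast
    have "flow (f (q (idx k))) (x (idx k)) \<sigma> = xs"
    proof (rule periodic_execution_eq_xs[OF m, where d = "\<lambda>k. d (idx k)" and x = "\<lambda>k. x (idx k)"
          and q = "\<lambda>k. q (idx k)"])
      fix k
      show "d (idx k) > 0"
        using r_less[of "idx k"] idx_range[of k] pos nonneg
        by (auto simp: d_def a_def b_def r_def)
      show "x (idx k) \<in> mode_dom g (q (idx k))"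
        using idx_range by (intro execution_start_in_dom[OF ex J])
      show "delay_bounded (q (idx k)) (x (idx k)) (d (idx k))"
        using idx_range by (rule delay_d)
      have sw: "q (Suc i) \<noteq> q i" "x (Suc i) = flow (f (q i)) (x i) (r (Suc i) - r i)"
        if "i < j2" for i
        using execution_switch[OF ex J[of "Suc i"]] that by (auto simp: piece_state_def r_def)
      \<comment> \<open>Where the cycle closes, the modes differ because
        \<open>q (Suc j0) \<noteq> q j0\<close> and \<open>q j0 = q j2\<close>.\<close>
      show "q (idx (Suc k)) \<noteq> q (idx k)"
        using sw(1)[of "idx k"] sw(1)[of j0] idx_range[of k] mode \<open>j0 < j2\<close>
        by (auto simp: idx_Suc)
      show "x (idx (Suc k)) = flow (f (q (idx k))) (x (idx k)) (d (idx k))"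
      proof (cases "idx k = j2")
        case True
        have "x (Suc j0) = flow (f (q j2)) (x j0) (a' + b)"
          using sw(2)[of j0] \<open>j0 < j2\<close> by (simp add: mode a'_def b_def)
        also have "\<dots> = flow (f (q j2)) (x j2) (a + b)"
          by (simp only: flow_plus glue)
        finally show ?thesis by (simp add: idx_Suc d_def True)
      next
        case False
        then show ?thesis using sw(2)[of "idx k"] idx_range[of k] by (simp add: idx_Suc d_def)
      qed
    qed (use \<sigma> k in \<open>simp_all add: idx_period\<close>)
    then show ?thesis by (simp add: k)
  qed
  show ?thesis
  proof (cases "j = j0")
    case True
    \<comment> \<open>States of piece \<open>j0\<close> after \<open>t0\<close> are found in the
      tail of the glued piece.\<close>
    have "piece_state f t q x j s = flow (f (q j2)) (x j0) (a' + (s - t0))"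
      by (simp add: piece_state_def True mode a'_def r_def)
    also have "\<dots> = flow (f (q j2)) (x j2) (a + (s - t0))"
      by (simp only: flow_plus glue)
    also have "\<dots> = xs"
      using s \<open>j0 < j2\<close> nonneg True t_eq[of "Suc j0"]
      by (intro on_loop) (auto simp: d_def b_def mode_interval_def)
    finally show ?thesis .
  next
    case False
    then show ?thesis
      using j s t_eq[of j] t_eq[of "Suc j"] nonneg unfolding piece_state_def r_def[symmetric]
      by (intro on_loop) (auto simp: d_def a_def mode_interval_def)
  qed
qed

text \<open>Three cases: the loop stays in one piece; it spans several pieces and the glued piece
  has positive length; or it starts at the end of one piece and closes at the start of another. In
  each case two states that differ would both be \<open>xs\<close>.\<close>

lemma no_closed_orbit:
  assumes "trajectory g f H T"
  shows "\<not> closed_orbit T"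
proof
  assume "closed_orbit T"
  obtain J t q x where ex: "execution g f H J t q x"
    and T: "T = (\<Union>j\<in>{j. enat j < J}. {(q j, s, piece_state f t q x j s) | s. s \<in> mode_interval t j})"
    using assms unfolding trajectory_def by blast
  from \<open>closed_orbit T\<close> obtain j0 t0 j1 t1 j2 t2 where
    J: "enat j0 < J" "enat j1 < J" "enat j2 < J"
    and int: "t0 \<in> mode_interval t j0" "t1 \<in> mode_interval t j1" "t2 \<in> mode_interval t j2"
    and mode: "q j2 = q j0" and less: "t0 < t1" "t1 < t2"
    and neq: "piece_state f t q x j1 t1 \<noteq> piece_state f t q x j2 t2"
    and loop: "piece_state f t q x j2 t2 = piece_state f t q x j0 t0"
    unfolding closed_orbit_def T by auto
  have j01: "j0 \<le> j1" and j12: "j1 \<le> j2"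
    using execution_index_le[OF ex] J int less by blast+
  show False
  proof (cases "j0 = j2")
    case True
    then have "j1 = j2" using j01 j12 by simp
    have "piece_state f t q x j2 s = xs" if "s \<in> mode_interval t j2" for s
      by (rule loop_in_piece_eq_xs[OF ex J(3), of t0 t2])
        (use True int less loop that in simp_all)
    then show False
      using neq int \<open>j1 = j2\<close> by simp
  next
    case False
    then have "j0 < j2" using j01 j12 by simp
    show False
    proof (cases "t0 < real_of_ereal (t (Suc j0)) \<or> real_of_ereal (t j2) < t2")
      case True
      note at_xs = loop_eq_xs[OF ex J(3) \<open>j0 < j2\<close> mode[symmetric] int(1,3) loop[symmetric] this]
      have "piece_state f t q x j1 t1 = xs" "piece_state f t q x j2 t2 = xs"
        using j01 j12 int less by (intro at_xs; simp)+
      then show False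
        using neq by simp
    next
      case False
      \<comment> \<open>The glued piece would have length zero, so both of its halves are dropped.\<close>
      obtain i2 where i2: "j2 = Suc i2" using \<open>j0 < j2\<close> by (cases j2) auto
      have J': "enat (Suc j0) < J" "enat i2 < J"
        using J(3) \<open>j0 < j2\<close> i2 by (metis Suc_leI enat_ord_simps(1) le_less_trans lessI less_imp_le)+
      have t: "t (Suc j0) = ereal t0" "t (Suc i2) = ereal t2"
      proof -
        obtain r1 r2 where "t (Suc j0) = ereal r1" "t j2 = ereal r2"
          using execution_finite_time[OF ex J'(1)] execution_finite_time[OF ex J(3)] by metis
        then show "t (Suc j0) = ereal t0" "t (Suc i2) = ereal t2"
          using False int i2 by (simp_all add: mode_interval_def)
      qed
      have int': "t0 \<in> mode_interval t (Suc j0)" "t2 \<in> mode_interval t i2"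
        using t execution_less_Suc[OF ex J'(1)] execution_less_Suc[OF ex J'(2)]
        by (auto simp: mode_interval_def less_imp_le)
      \<comment> \<open>\<open>t1\<close> lies strictly between \<open>t0\<close> and
        \<open>t2\<close>, so its piece survives the trimming.\<close>
      have j01': "Suc j0 \<le> j1" and j12': "j1 \<le> i2"
        using execution_index_le[OF ex] J J' int int' less by blast+
      have start: "piece_state f t q x (Suc j0) t0 = piece_state f t q x j0 t0"
        using execution_switch(2)[OF ex J'(1)] t by (simp add: piece_state_def)
      have finish: "piece_state f t q x i2 t2 = piece_state f t q x j2 t2"
        using execution_switch(2)[OF ex, of i2] J(3) i2 t by (simp add: piece_state_def)
      \<comment> \<open>With only two modes, the successor and the predecessor of the same mode
        coincide.\<close>
      have mode': "q (Suc j0) = q i2"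
        using execution_switch(1)[OF ex J'(1)] execution_switch(1)[OF ex, of i2] J(3) i2 mode
        by (metis (full_types) mode.exhaust)
      have loop': "piece_state f t q x (Suc j0) t0 = piece_state f t q x i2 t2"
        using loop start finish by simp
      have "piece_state f t q x j1 t1 = xs \<and> piece_state f t q x i2 t2 = xs"
      proof (cases "Suc j0 = i2")
        case True
        then have "j1 = i2" using j01' j12' by simp
        have "piece_state f t q x i2 s = xs" if "s \<in> mode_interval t i2" for s
          by (rule loop_in_piece_eq_xs[OF ex J'(2), of t0 t2])
            (use True int' less loop' that in simp_all)
        then show ?thesis
          using int int' \<open>j1 = i2\<close> by simp
      next
        case False
        then have "Suc j0 < i2" using j01' j12' by simp
        \<comment> \<open>After trimming, the loop closes at the end of piece \<open>i2\<close>,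
          which has positive length.\<close>
        have "real_of_ereal (t i2) < t2"
          using execution_less_Suc[OF ex J'(2)] execution_finite_time[OF ex J'(2)] t(2)
          by (metis less_ereal.simps(1))
        then have "t0 < real_of_ereal (t (Suc (Suc j0))) \<or> real_of_ereal (t i2) < t2" ..
        note at_xs = loop_eq_xs[OF ex J'(2) \<open>Suc j0 < i2\<close> mode' int' loop' this]
        show ?thesis
          using j01' j12' int int' less by (intro conjI at_xs; simp)
      qed
      then show False
        using neq finish by simp
    qed
  qed
qed

end

theorem proposition2:
  fixes g :: "real ^ 'n \<Rightarrow> real"
    and f :: "mode \<Rightarrow> real ^ 'n \<Rightarrow> real ^ 'n"
    and xs :: "real ^ 'n"
    and H :: real
  assumes "bimodal_automaton g f"
    and "unique_equilibrium g f xs"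
    and "GAS_ode (f Mode1) xs"
    and "GAS g f 0 xs"
    and "H \<ge> 0"
    and "\<exists>T. trajectory g f H T \<and> closed_orbit T"
  shows "\<not> GAS g f H xs"
proof
  assume "GAS g f H xs"
  then interpret attractive_delayed_automaton g f H xs
    using assms by unfold_locales (auto simp: bimodal_automaton_def GAS_def)
  show False
    using no_closed_orbit assms(6) by blast
qed

end
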